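(* Let $K$ be an uncountable metrizable compact space. Then there is no locally convex topology $\tau$ on $\mathcal{C}(K)^*$ such that $\text{(I)-env}(A)=\overline{\operatorname{conv} A}^{\tau}$ for each $A\subset \mathcal{C}(K)^*$.
   Context: $\mathcal{C}(K)$ is the Banach space of (real or complex) continuous functions on $K$ with the supremum norm. For a Banach space $X$ and $A\subset X^*$, the (I)-envelope of $A$ is $$\text{(I)-env}(A)= \bigcap\left\{\overline{\operatorname{conv}\bigcup_{n=1}^\infty \overline{\operatorname{conv} A_n}^{w^*}}^{\|\cdot\|} : A=\bigcup_{n=1}^\infty A_n\right\},$$ the intersection being over all countable covers $A=\bigcup_n A_n$ by subsets of $A$. Here $\operatorname{conv}$ is the convex hull. $\overline{A}^{\tau}$ denotes the closure of $A$ in the topology $\tau$. A locally convex topology is a vector space topology having a base of neighborhoods of zero consisting of convex sets. *)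

theory Defs
  imports "HOL-Analysis.Analysis"
begin

text \<open>
  The scalar field is a type \<open>'s\<close>, instantiated to \<open>real\<close> and \<open>complex\<close>.  The spaces
  \<open>'k \<Rightarrow>\<^sub>C 's\<close> and \<open>'x \<Rightarrow>\<^sub>L 's\<close> of the library are only real vector spaces (and the
  elements of the latter only real-linear maps), so multiplication by elements of \<open>'s\<close> is
  defined here, and the dual is carved out as the set of \<open>'s\<close>-linear elements of
  \<open>'x \<Rightarrow>\<^sub>L 's\<close>.  For compact \<open>'k\<close>, the type \<open>'k \<Rightarrow>\<^sub>C 's\<close> with its library norm is the
  space of all continuous functions with the supremum norm.
\<close>

definition scale_bcontfun ::
  "'s::real_normed_field \<Rightarrow> ('k::topological_space \<Rightarrow>\<^sub>C 's) \<Rightarrow> ('k \<Rightarrow>\<^sub>C 's)"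
  where "scale_bcontfun c f = Bcontfun (\<lambda>x. c * apply_bcontfun f x)"

lemma apply_scale_bcontfun:
  "apply_bcontfun (scale_bcontfun c f) x = c * apply_bcontfun f x"
proof -
  have "bounded ((\<lambda>y. c * y) ` range (apply_bcontfun f))"
    by (intro bounded_linear_image bounded_linear_mult_right) simp
  then have "(\<lambda>x. c * apply_bcontfun f x) \<in> bcontfun"
    by (auto simp: bcontfun_def image_image intro!: continuous_intros)
  then show ?thesis
    by (simp add: scale_bcontfun_def Bcontfun_inverse)
qed

definition scale_functional ::
  "'s::real_normed_field \<Rightarrow> ('x::real_normed_vector \<Rightarrow>\<^sub>L 's) \<Rightarrow> ('x \<Rightarrow>\<^sub>L 's)"
  where "scale_functional c \<phi> = blinfun_mult_right c o\<^sub>L \<phi>"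

text \<open>In the following, \<open>sc\<close> is the scalar multiplication of \<open>'x\<close> over \<open>'s\<close>.\<close>

definition dual ::
  "('s::real_normed_field \<Rightarrow> 'x::real_normed_vector \<Rightarrow> 'x) \<Rightarrow> ('x \<Rightarrow>\<^sub>L 's) set"
  where "dual sc = {\<phi>. \<forall>c x. blinfun_apply \<phi> (sc c x) = c * blinfun_apply \<phi> x}"

text \<open>
  For scalar-valued maps the library's strong operator topology is the topology of pointwise
  convergence.
\<close>

definition weak_star_topology ::
  "('s::real_normed_field \<Rightarrow> 'x::real_normed_vector \<Rightarrow> 'x) \<Rightarrow> ('x \<Rightarrow>\<^sub>L 's) topology"
  where "weak_star_topology sc = subtopology strong_operator_topology (dual sc)"

definition I_env ::
  "('s::real_normed_field \<Rightarrow> 'x::real_normed_vector \<Rightarrow> 'x) \<Rightarrow> ('x \<Rightarrow>\<^sub>L 's) set \<Rightarrow> ('x \<Rightarrow>\<^sub>L 's) set"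
  where "I_env sc A =
    \<Inter> {top_of_set (dual sc) closure_of
          (convex hull (\<Union>n. weak_star_topology sc closure_of (convex hull (B n)))) | B :: nat \<Rightarrow> _.
        A = (\<Union>n. B n)}"

text \<open>
  \<open>S\<close> is (the carrier of) a vector space with scalar multiplication \<open>sc\<close>.  No separation
  property is required of a locally convex topology, and the convex neighbourhoods of zero
  need not be open.
\<close>

definition vector_space_topology ::
  "('s::real_normed_field \<Rightarrow> 'v::real_vector \<Rightarrow> 'v) \<Rightarrow> 'v set \<Rightarrow> 'v topology \<Rightarrow> bool"
  where "vector_space_topology sc S \<tau> \<longleftrightarrow>
    topspace \<tau> = S \<and>
    continuous_map (prod_topology \<tau> \<tau>) \<tau> (\<lambda>(x, y). x + y) \<and>
    continuous_map (prod_topology euclidean \<tau>) \<tau> (\<lambda>(c, x). sc c x)"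

definition locally_convex_topology ::
  "('s::real_normed_field \<Rightarrow> 'v::real_vector \<Rightarrow> 'v) \<Rightarrow> 'v set \<Rightarrow> 'v topology \<Rightarrow> bool"
  where "locally_convex_topology sc S \<tau> \<longleftrightarrow>
    vector_space_topology sc S \<tau> \<and>
    (\<forall>U. openin \<tau> U \<and> 0 \<in> U \<longrightarrow>
      (\<exists>V W. convex V \<and> openin \<tau> W \<and> 0 \<in> W \<and> W \<subseteq> V \<and> V \<subseteq> U))"

end

theory Submission
  imports Defs
begin

text \<open>
  Suppose that \<open>\<tau>\<close> is a locally convex topology whose closed convex hulls are the
  (I)-envelopes.  Since \<open>K\<close> is uncountable, it has a nonempty closed subset \<open>P\<close> without
  isolated points, and two disjoint countable sets \<open>E\<close> and \<open>E'\<close>, both dense in \<open>P\<close>.  No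
  function of the first Baire class is constant on \<open>E\<close> and on \<open>E'\<close> with two different values;
  in the form used here: \<open>K\<close> is not the union of countably many closed sets that miss \<open>E\<close> and
  countably many closed sets that miss \<open>E'\<close> (\<open>countable_sets_not_sigma_separated\<close>).  On the
  other hand, the envelope of a countable set is just a norm closed convex hull, which is
  insensitive to Baire class, whereas the envelope of a half-space is so large that half-spaces
  equal to their envelope come from functionals of the first Baire class.  These two facts
  conflict as follows.

  Fix \<open>e\<^sub>0 \<in> E\<close> and let \<open>A\<close> be the span of all \<open>\<delta>\<^sub>x\<close> with \<open>x \<in> E'\<close> and all
  \<open>\<delta>\<^sub>e - \<delta>\<close> with \<open>e \<in> E\<close>, where \<open>\<delta>\<close> is the point mass at \<open>e\<^sub>0\<close>.
  It is the convex hull of a countable set (\<open>convex_hull_int_multiples\<close>), so its \<open>\<tau>\<close>-closure is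
  its norm closure, which does not contain \<open>\<delta>\<close> (\<open>dirac_not_in_closure_span\<close>).

  A continuous functional vanishing on \<open>A\<close> but not at \<open>\<delta>\<close> would cut the dual into two
  half-spaces.  Only the following is needed of them: by local convexity and the
  Kakutani--Stone separation theorem, the dual is the disjoint union of convex sets \<open>C \<supseteq> A\<close> and
  \<open>D \<supseteq> \<delta> + A\<close> such that \<open>\<delta>\<close> is not in the \<open>\<tau>\<close>-closure of \<open>C\<close> and \<open>0\<close> is not
  in the \<open>\<tau>\<close>-closure of \<open>D\<close> (\<open>convex_splitting_of_locally_convex_space\<close>).  These closures
  are (I)-envelopes, so \<open>C\<close> is covered by sets \<open>B\<^sub>n\<close> whose weak* closed convex hulls lie in a
  norm closed convex set \<open>N \<supseteq> C\<close> that does not contain \<open>\<delta>\<close>.  As \<open>N\<close> contains \<open>A\<close>, it is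
  invariant under translations from \<open>A\<close> (\<open>closed_convex_plus_subspace\<close>).  Hence it contains
  none of the \<open>\<delta>\<^sub>e\<close> with \<open>e \<in> E\<close>, and so the closed sets of all \<open>x\<close> for which \<open>\<delta>\<^sub>x\<close> lies in the
  weak* closed convex hull of \<open>B\<^sub>n\<close> miss \<open>E\<close>.  In the same way \<open>D\<close> yields closed sets that
  miss \<open>E'\<close>.  Each \<open>\<delta>\<^sub>x\<close> is in \<open>C\<close> or in \<open>D\<close>, so these countably many closed sets cover
  \<open>K\<close>: a contradiction.
\<close>

section \<open>Separation of convex sets\<close>

lemma extend_to_maximal_convex_disjoint:
  fixes C\<^sub>0 D :: "'a::real_vector set"
  assumes "convex C\<^sub>0" "C\<^sub>0 \<inter> D = {}"
  obtains C where "convex C" "C\<^sub>0 \<subseteq> C" "C \<inter> D = {}"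
    "\<And>C'. \<lbrakk>convex C'; C \<subseteq> C'; C' \<inter> D = {}\<rbrakk> \<Longrightarrow> C' = C"
proof -
  let ?\<A> = "{C. convex C \<and> C\<^sub>0 \<subseteq> C \<and> C \<inter> D = {}}"
  have "\<exists>M\<in>?\<A>. \<forall>X\<in>?\<A>. M \<subseteq> X \<longrightarrow> X = M"
  proof (rule subset_Zorn_nonempty)
    show "?\<A> \<noteq> {}"
      using assms by blast
    fix \<C> assume ne: "\<C> \<noteq> {}" and chain: "subset.chain ?\<A> \<C>"
    have sub: "\<C> \<subseteq> ?\<A>" and lin: "\<And>X Y. X \<in> \<C> \<Longrightarrow> Y \<in> \<C> \<Longrightarrow> X \<subseteq> Y \<or> Y \<subseteq> X"
      using chain by (auto simp: subset_chain_def)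
    have "convex (\<Union>\<C>)"
    proof (rule convexI)
      fix x y and u v :: real
      assume "x \<in> \<Union>\<C>" "y \<in> \<Union>\<C>" and uv: "0 \<le> u" "0 \<le> v" "u + v = 1"
      then obtain X Y where "X \<in> \<C>" "Y \<in> \<C>" "x \<in> X" "y \<in> Y"
        by blast
      then obtain Z where Z: "Z \<in> \<C>" "x \<in> Z" "y \<in> Z"
        using lin[of X Y] by (metis subsetD)
      then have "convex Z"
        using sub by blast
      then have "u *\<^sub>R x + v *\<^sub>R y \<in> Z"
        using Z uv by (simp add: convexD)
      then show "u *\<^sub>R x + v *\<^sub>R y \<in> \<Union>\<C>"
        using Z by blast
    qed
    moreover have "C\<^sub>0 \<subseteq> \<Union>\<C>" "\<Union>\<C> \<inter> D = {}"
      using sub ne by (auto simp: subset_iff)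
    ultimately show "\<Union>\<C> \<in> ?\<A>"
      by simp
  qed
  then obtain M where M: "M \<in> ?\<A>" and max: "\<forall>X\<in>?\<A>. M \<subseteq> X \<longrightarrow> X = M"
    by (elim bexE)
  show thesis
  proof (rule that)
    show "convex M" "C\<^sub>0 \<subseteq> M" "M \<inter> D = {}"
      using M by simp_all
    fix C' assume "convex C'" "M \<subseteq> C'" "C' \<inter> D = {}"
    then show "C' = M"
      using \<open>C\<^sub>0 \<subseteq> M\<close> by (intro max[rule_format]) auto
  qed
qed

text \<open>
  The Kakutani--Stone theorem.  Enlarge \<open>C\<^sub>0\<close> to a set \<open>C\<close> that is maximal among the convex sets
  disjoint from \<open>D\<^sub>0\<close>, and then \<open>D\<^sub>0\<close> to a set \<open>D\<close> that is maximal among those disjoint from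
  \<open>C\<close>.  If a point \<open>x\<close> were in neither, maximality would give a segment from \<open>x\<close> to \<open>C\<close> that
  meets \<open>D\<close> and a segment from \<open>x\<close> to \<open>D\<close> that meets \<open>C\<close>.  In the plane of these two segments
  one finds a common point of \<open>C\<close> and \<open>D\<close>.
\<close>
lemma complementary_convex_sets:
  fixes C\<^sub>0 D\<^sub>0 :: "'a::real_vector set"
  assumes "convex C\<^sub>0" "convex D\<^sub>0" "C\<^sub>0 \<noteq> {}" "D\<^sub>0 \<noteq> {}" "C\<^sub>0 \<inter> D\<^sub>0 = {}"
  obtains C D where "convex C" "convex D" "C\<^sub>0 \<subseteq> C" "D\<^sub>0 \<subseteq> D" "C \<inter> D = {}" "C \<union> D = UNIV"
proof -
  obtain C where C: "convex C" "C\<^sub>0 \<subseteq> C" "C \<inter> D\<^sub>0 = {}"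
    and Cmax: "\<And>C'. \<lbrakk>convex C'; C \<subseteq> C'; C' \<inter> D\<^sub>0 = {}\<rbrakk> \<Longrightarrow> C' = C"
    using extend_to_maximal_convex_disjoint assms by metis
  have "D\<^sub>0 \<inter> C = {}"
    using C by blast
  then obtain D where D: "convex D" "D\<^sub>0 \<subseteq> D" "D \<inter> C = {}"
    and Dmax: "\<And>D'. \<lbrakk>convex D'; D \<subseteq> D'; D' \<inter> C = {}\<rbrakk> \<Longrightarrow> D' = D"
    using extend_to_maximal_convex_disjoint assms by metis
  have "x \<in> C \<union> D" for x
  proof (rule ccontr)
    assume x: "x \<notin> C \<union> D"
    have hulls: "convex hull C = C" "convex hull D = D" "C \<noteq> {}" "D \<noteq> {}"
      using C D assms by (auto simp: hull_same)
    have "convex hull (insert x C) \<inter> D\<^sub>0 \<noteq> {}"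
      using Cmax[of "convex hull (insert x C)"] x hull_subset[of "insert x C" convex] by auto
    then obtain d where "d \<in> D" "d \<in> convex hull (insert x C)"
      using D(2) by blast
    then obtain s s' c where s: "0 \<le> s" "0 \<le> s'" "s + s' = 1" "c \<in> C" "d \<in> D" "d = s *\<^sub>R x + s' *\<^sub>R c"
      unfolding convex_hull_insert[OF hulls(3)] hulls(1) by auto
    have "convex hull (insert x D) \<inter> C \<noteq> {}"
      using Dmax[of "convex hull (insert x D)"] x hull_subset[of "insert x D" convex] by auto
    then obtain c' where "c' \<in> C" "c' \<in> convex hull (insert x D)"
      by blast
    then obtain t t' d' where t: "0 \<le> t" "0 \<le> t'" "t + t' = 1" "d' \<in> D" "c' \<in> C" "c' = t *\<^sub>R x + t' *\<^sub>R d'"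
      unfolding convex_hull_insert[OF hulls(4)] hulls(2) by auto
    have "s \<noteq> 0"
      using s D(3) by auto
    moreover have "t \<noteq> 0"
      using t D(3) by auto
    ultimately have st: "s > 0" "t > 0"
      using s t by auto
    \<comment> \<open>The sum of the coefficients of \<open>x\<close>, \<open>c\<close> and \<open>d'\<close> in \<open>z\<close> below.\<close>
    define q where "q = t + s * t'"
    have q: "q > 0"
      using st t by (simp add: q_def add_pos_nonneg)
    have q2: "q = s + t * s'"
      using s(3) t(3) unfolding q_def by algebra
    \<comment> \<open>The segments from \<open>c\<close> to \<open>c'\<close> and from \<open>d\<close> to \<open>d'\<close> cross at \<open>(1 / q) *\<^sub>R z\<close>.\<close>
    define z where "z = (s * t) *\<^sub>R x + (t * s') *\<^sub>R c + (s * t') *\<^sub>R d'"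
    have "(t / q) *\<^sub>R d + (s * t' / q) *\<^sub>R d' \<in> D"
      using s t st q by (intro convexD[OF D(1)]) (auto simp: q_def simp flip: add_divide_distrib)
    moreover have "(t / q) *\<^sub>R d + (s * t' / q) *\<^sub>R d' = (1 / q) *\<^sub>R z"
      unfolding z_def s(6) by (simp add: algebra_simps)
    moreover have "(s / q) *\<^sub>R c' + (t * s' / q) *\<^sub>R c \<in> C"
      using s t st q by (intro convexD[OF C(1)]) (auto simp: q2 simp flip: add_divide_distrib)
    moreover have "(s / q) *\<^sub>R c' + (t * s' / q) *\<^sub>R c = (1 / q) *\<^sub>R z"
      unfolding z_def t(6) by (simp add: algebra_simps)
    ultimately show False
      using D(3) by auto
  qed
  then show thesis
    using C D by (intro that[of C D]) auto
qed

text \<open>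
  This makes the span of a countable set the convex hull of a countable set.  Invariance under
  multiplication by integers passes from the set to its hull, and convexity supplies the
  remaining scalars.
\<close>
lemma convex_hull_int_multiples:
  fixes S :: "'a::real_vector set"
  assumes "S \<noteq> {}"
  shows "convex hull ((\<lambda>(n, s). of_int n *\<^sub>R s) ` (UNIV \<times> S)) = span S"
proof
  let ?T = "(\<lambda>(n::int, s). of_int n *\<^sub>R s) ` (UNIV \<times> S)"
  show "convex hull ?T \<subseteq> span S"
    by (rule hull_minimal) (auto intro: span_scale span_base subspace_imp_convex)
  have scale_int: "of_int k *\<^sub>R x \<in> convex hull ?T" if "x \<in> convex hull ?T" for k x
  proof -
    have "(\<lambda>x. of_int k *\<^sub>R x) ` ?T \<subseteq> ?T"
    proof clarsimp
      fix n s assume "s \<in> S"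
      then show "(of_int k * of_int n) *\<^sub>R s \<in> ?T"
        by (intro image_eqI[of _ _ "(k * n, s)"]) auto
    qed
    then have "convex hull ((\<lambda>x. of_int k *\<^sub>R x) ` ?T) \<subseteq> convex hull ?T"
      by (rule hull_mono)
    then show ?thesis
      using that by (auto simp: convex_hull_scaling)
  qed
  have "subspace (convex hull ?T)"
  proof (rule subspaceI)
    obtain s where "s \<in> S"
      using assms by blast
    then have "0 \<in> ?T"
      by (intro image_eqI[of _ _ "(0, s)"]) auto
    then show "0 \<in> convex hull ?T"
      by (rule hull_inc)
  next
    fix x y assume "x \<in> convex hull ?T" "y \<in> convex hull ?T"
    then have "2 *\<^sub>R x \<in> convex hull ?T" "2 *\<^sub>R y \<in> convex hull ?T"
      using scale_int[of _ 2] by auto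
    then have "(1/2) *\<^sub>R (2 *\<^sub>R x) + (1/2) *\<^sub>R (2 *\<^sub>R y) \<in> convex hull ?T"
      by (intro convexD[OF convex_convex_hull]) auto
    then show "x + y \<in> convex hull ?T"
      by simp
  next
    fix r x assume "x \<in> convex hull ?T"
    \<comment> \<open>\<open>r\<close> lies between two consecutive integers.\<close>
    then have "(1 - frac r) *\<^sub>R (of_int \<lfloor>r\<rfloor> *\<^sub>R x) + frac r *\<^sub>R (of_int (\<lfloor>r\<rfloor> + 1) *\<^sub>R x)
        \<in> convex hull ?T"
      by (intro convexD[OF convex_convex_hull] scale_int) (auto simp: less_imp_le[OF frac_lt_1])
    moreover have "(1 - frac r) * of_int \<lfloor>r\<rfloor> + frac r * of_int (\<lfloor>r\<rfloor> + 1) = r"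
      by (simp add: algebra_simps frac_def)
    ultimately show "r *\<^sub>R x \<in> convex hull ?T"
      by (metis scaleR_add_left scaleR_scaleR)
  qed
  moreover have "S \<subseteq> convex hull ?T"
    by (force intro: hull_inc image_eqI[of _ _ "(1, s)" for s])
  ultimately show "span S \<subseteq> convex hull ?T"
    by (intro span_minimal)
qed

text \<open>
  A closed convex set that contains a translate of a subspace is invariant under that subspace:
  the segments from \<open>y\<close> to points \<open>z + (1 / s) *\<^sub>R a\<close> that move away to infinity approach the
  ray from \<open>y\<close> in direction \<open>a\<close>.
\<close>
lemma closed_convex_plus_subspace:
  fixes N :: "'a::real_normed_vector set"
  assumes "convex N" "closedin (top_of_set S) N" "subspace S" "subspace A" "A \<subseteq> S"
    and z: "\<And>a. a \<in> A \<Longrightarrow> z + a \<in> N" and "y \<in> N" "a \<in> A"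
  shows "y + a \<in> N"
proof -
  obtain F where F: "closed F" "N = S \<inter> F"
    using assms(2) by (auto simp: closedin_closed)
  have "y \<in> S"
    using \<open>y \<in> N\<close> F by simp
  \<comment> \<open>The convex combination of \<open>y\<close> and \<open>z + (1 / s) *\<^sub>R a\<close> with weights \<open>1 - s\<close> and \<open>s\<close>.\<close>
  define p where "p = (\<lambda>s::real. (1 - s) *\<^sub>R y + s *\<^sub>R z + a)"
  have "p s \<in> N" if "0 < s" "s < 1" for s
  proof -
    have "(1 / s) *\<^sub>R a \<in> A"
      using subspace_scale[OF \<open>subspace A\<close> \<open>a \<in> A\<close>] .
    then have "(1 - s) *\<^sub>R y + s *\<^sub>R (z + (1 / s) *\<^sub>R a) \<in> N"
      using convexD[OF \<open>convex N\<close> \<open>y \<in> N\<close> z, of _ "1 - s" s] that by simp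
    moreover have "s *\<^sub>R (z + (1 / s) *\<^sub>R a) = s *\<^sub>R z + a"
      using that by (simp add: scaleR_add_right)
    ultimately show ?thesis
      by (simp add: p_def add.assoc)
  qed
  then have ev: "eventually (\<lambda>s. p s \<in> F) (at_right 0)"
    using eventually_at_right_real[of 0 1] F(2) by (auto elim!: eventually_mono)
  have lim: "(p \<longlongrightarrow> (1 - 0) *\<^sub>R y + 0 *\<^sub>R z + a) (at_right 0)"
    unfolding p_def by (intro tendsto_intros)
  have "y + a \<in> F"
    using Lim_in_closed_set[OF F(1) ev _ lim] by (simp add: trivial_limit_at_right_real)
  then show ?thesis
    using F(2) subspace_add[OF \<open>subspace S\<close> \<open>y \<in> S\<close>] \<open>A \<subseteq> S\<close> \<open>a \<in> A\<close> by auto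
qed

text \<open>
  A substitute for the half-spaces of a continuous functional that vanishes on \<open>A\<close> and is
  positive at \<open>x0\<close>.  If \<open>V\<close> is a convex neighbourhood of zero such that \<open>V - V\<close> does not meet
  \<open>A - x0\<close>, then \<open>A + V\<close> and \<open>x0 + A + V\<close> are disjoint and can be enlarged to complementary
  convex sets.  Being neighbourhoods of zero and of \<open>x0\<close>, they keep these two points away from the
  closure of the opposite set.
\<close>
lemma convex_splitting_of_locally_convex_space:
  fixes \<tau> :: "'v::real_vector topology" and sc :: "'s::real_normed_field \<Rightarrow> 'v \<Rightarrow> 'v"
  assumes lc: "locally_convex_topology sc S \<tau>" and S: "subspace S"
    and minus: "\<And>x. x \<in> S \<Longrightarrow> sc (-1) x = - x"
    and A: "subspace A" "A \<subseteq> S" and x0: "x0 \<in> S" "x0 \<notin> \<tau> closure_of A"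
  obtains C D where "convex C" "convex D" "C \<inter> D = {}" "C \<union> D = UNIV"
    "A \<subseteq> C" "\<And>a. a \<in> A \<Longrightarrow> x0 + a \<in> D"
    "x0 \<notin> \<tau> closure_of (S \<inter> C)" "0 \<notin> \<tau> closure_of (S \<inter> D)"
proof -
  have top: "topspace \<tau> = S"
    and add: "continuous_map (prod_topology \<tau> \<tau>) \<tau> (\<lambda>(x, y). x + y)"
    and sc: "continuous_map (prod_topology euclidean \<tau>) \<tau> (\<lambda>(c, x). sc c x)"
    using lc by (auto simp: locally_convex_topology_def vector_space_topology_def)
  have S0: "0 \<in> S" and A0: "0 \<in> A"
    using S A by (auto simp: subspace_0)
  have translate: "continuous_map \<tau> \<tau> (\<lambda>v. x + v)" if "x \<in> S" for x
  proof -
    have "continuous_map \<tau> (prod_topology \<tau> \<tau>) (\<lambda>v. (x, v))"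
      using that top by (intro continuous_map_pairedI) auto
    from continuous_map_compose[OF this add] show ?thesis
      by (simp add: o_def)
  qed
  have neg: "continuous_map \<tau> \<tau> uminus"
  proof -
    have "continuous_map \<tau> (prod_topology euclidean \<tau>) (\<lambda>v. (-1, v))"
      by (intro continuous_map_pairedI) auto
    from continuous_map_compose[OF this sc] have "continuous_map \<tau> \<tau> (\<lambda>v. sc (-1) v)"
      by (simp add: o_def)
    then show ?thesis
      by (rule continuous_map_eq) (use minus top in auto)
  qed
  have diff: "continuous_map (prod_topology \<tau> \<tau>) \<tau> (\<lambda>(x, y). x - y)"
  proof -
    have "continuous_map (prod_topology \<tau> \<tau>) (prod_topology \<tau> \<tau>) (\<lambda>p. (fst p, - snd p))"
      using continuous_map_compose[OF continuous_map_snd neg, of \<tau>]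
      by (intro continuous_map_pairedI continuous_map_fst) (simp add: o_def)
    from continuous_map_compose[OF this add] show ?thesis
      by (simp add: o_def case_prod_unfold)
  qed
  define U where "U = {v \<in> topspace \<tau>. x0 + v \<in> topspace \<tau> - \<tau> closure_of A}"
  have "openin \<tau> U"
    unfolding U_def by (intro openin_continuous_map_preimage[OF translate] x0 openin_diff) auto
  then have "openin (prod_topology \<tau> \<tau>) {p \<in> topspace (prod_topology \<tau> \<tau>). (\<lambda>(x, y). x - y) p \<in> U}"
    by (rule openin_continuous_map_preimage[OF diff])
  moreover have "(0, 0) \<in> {p \<in> topspace (prod_topology \<tau> \<tau>). (\<lambda>(x, y). x - y) p \<in> U}"
    using x0 S0 top by (auto simp: U_def)
  ultimately have "\<exists>W1 W2. openin \<tau> W1 \<and> openin \<tau> W2 \<and> 0 \<in> W1 \<and> 0 \<in> W2 \<and>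
      W1 \<times> W2 \<subseteq> {p \<in> topspace (prod_topology \<tau> \<tau>). (\<lambda>(x, y). x - y) p \<in> U}"
    unfolding openin_prod_topology_alt by (elim allE impE)
  then obtain W1 W2 where W12: "openin \<tau> W1" "openin \<tau> W2" "0 \<in> W1" "0 \<in> W2"
    "W1 \<times> W2 \<subseteq> {p \<in> topspace (prod_topology \<tau> \<tau>). (\<lambda>(x, y). x - y) p \<in> U}"
    by (elim exE conjE)
  then have "openin \<tau> (W1 \<inter> W2)" "0 \<in> W1 \<inter> W2"
    by auto
  with lc obtain V W where VW: "convex V" "openin \<tau> W" "0 \<in> W" "W \<subseteq> V" "V \<subseteq> W1 \<inter> W2"
    unfolding locally_convex_topology_def by meson
  have V_diff: "v - v' \<in> U" if "v \<in> V" "v' \<in> V" for v v'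
    using that VW W12 by fastforce
  have A_U: "x0 + u \<notin> A" if "u \<in> U" for u
    using that closure_of_subset[of A \<tau>] A top by (auto simp: U_def)
  define C\<^sub>0 where "C\<^sub>0 = {a + v | a v. a \<in> A \<and> v \<in> V}"
  define D\<^sub>0 where "D\<^sub>0 = (+) x0 ` C\<^sub>0"
  have "convex C\<^sub>0"
    using convex_sums[OF subspace_imp_convex[OF A(1)] VW(1)]
    by (rule back_subst) (auto simp: C\<^sub>0_def)
  moreover from this have "convex D\<^sub>0"
    unfolding D\<^sub>0_def by (rule convex_translation)
  moreover have "0 \<in> C\<^sub>0"
    using A0 VW unfolding C\<^sub>0_def by force
  moreover have "C\<^sub>0 \<inter> D\<^sub>0 = {}"
  proof (rule ccontr)
    assume "C\<^sub>0 \<inter> D\<^sub>0 \<noteq> {}"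
    then obtain y where "y \<in> C\<^sub>0" "x0 + y \<in> C\<^sub>0"
      unfolding D\<^sub>0_def by auto
    then obtain a v a' v' where *: "a \<in> A" "a' \<in> A" "v \<in> V" "v' \<in> V" "x0 + (a' + v') = a + v"
      unfolding C\<^sub>0_def by blast
    then have "x0 + (v' - v) = a - a'"
      by (simp add: algebra_simps)
    then show False
      using A_U[OF V_diff[of v' v]] * A by (simp add: subspace_diff)
  qed
  ultimately obtain C D where CD: "convex C" "convex D" "C\<^sub>0 \<subseteq> C" "D\<^sub>0 \<subseteq> D" "C \<inter> D = {}" "C \<union> D = UNIV"
    using complementary_convex_sets[of C\<^sub>0 D\<^sub>0] by (auto simp: D\<^sub>0_def)
  have AC: "A \<subseteq> C\<^sub>0" and VC: "V \<subseteq> C\<^sub>0"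
    using A0 VW unfolding C\<^sub>0_def by force+
  show thesis
  proof (rule that[OF CD(1,2,5,6)])
    show "A \<subseteq> C" "\<And>a. a \<in> A \<Longrightarrow> x0 + a \<in> D"
      using AC CD unfolding D\<^sub>0_def by auto
    show "x0 \<notin> \<tau> closure_of (S \<inter> C)"
    proof -
      have "openin \<tau> {y \<in> topspace \<tau>. - x0 + y \<in> W}"
        by (rule openin_continuous_map_preimage[OF translate VW(2)]) (use S x0 in \<open>simp add: subspace_neg\<close>)
      moreover have sub: "{y \<in> topspace \<tau>. - x0 + y \<in> W} \<subseteq> D"
      proof clarify
        fix y assume "- x0 + y \<in> W"
        then have "x0 + (- x0 + y) \<in> D\<^sub>0"
          using VW VC unfolding D\<^sub>0_def by blast
        then show "y \<in> D"
          using CD by auto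
      qed
      moreover have "x0 \<in> {y \<in> topspace \<tau>. - x0 + y \<in> W}"
        using x0 top VW by simp
      ultimately show ?thesis
        unfolding in_closure_of using sub CD(5) by (metis (no_types, lifting) IntD2 disjoint_iff subsetD)
    qed
    show "0 \<notin> \<tau> closure_of (S \<inter> D)"
    proof -
      have "W \<inter> D = {}"
        using VW(4) VC CD(3,5) by blast
      then show ?thesis
        using VW(2,3) unfolding in_closure_of by (metis IntD2 disjoint_iff)
    qed
  qed
qed

section \<open>Dense sets in uncountable compact metrizable spaces\<close>

lemma second_countable_compact_metrizable:
  assumes "compact_space X" "metrizable_space X"
  shows "second_countable X"
proof -
  obtain M d where Md: "Metric_space M d" and X: "X = Metric_space.mtopology M d"
    using assms(2) unfolding metrizable_space_def by blast
  interpret Metric_space M d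
    by (rule Md)
  have "mtotally_bounded M"
    using assms(1) X compactin_imp_mtotally_bounded[of M] by (simp add: compact_space_def)
  then have "\<exists>K. finite K \<and> K \<subseteq> M \<and> M \<subseteq> (\<Union>x\<in>K. mball x (1 / Suc n))" for n
    unfolding mtotally_bounded_def by simp
  then obtain K where K: "\<And>n. finite (K n)" "\<And>n. K n \<subseteq> M"
    "\<And>n. M \<subseteq> (\<Union>x\<in>K n. mball x (1 / Suc n))"
    by metis
  define \<B> where "\<B> = (\<Union>n. (\<lambda>x. mball x (1 / Suc n)) ` K n)"
  show ?thesis
    unfolding second_countable_def
  proof (intro exI[of _ \<B>] conjI ballI allI impI)
    show "countable \<B>"
      unfolding \<B>_def using K by (intro countable_UN) (auto intro: countable_finite)
    show "openin X V" if "V \<in> \<B>" for V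
      using that X by (auto simp: \<B>_def)
    fix U x assume "openin X U \<and> x \<in> U"
    then have "openin mtopology U" "x \<in> U"
      using X by simp_all
    then have "x \<in> M" "\<exists>r>0. mball x r \<subseteq> U"
      by (auto simp: openin_mtopology)
    then obtain r where r: "r > 0" "mball x r \<subseteq> U" "x \<in> M"
      by blast
    obtain n where n: "1 / Suc n < r / 2"
      using nat_approx_posE[of "r / 2"] r(1) by auto
    obtain y where y: "y \<in> K n" "x \<in> mball y (1 / Suc n)"
      using K r by blast
    have "mball y (1 / Suc n) \<subseteq> mball x r"
    proof
      fix z assume z: "z \<in> mball y (1 / Suc n)"
      have "d x z \<le> d x y + d y z"
        using y z r by (intro triangle) auto
      also have "\<dots> < r"
        using y z n commute[of x y] by (auto simp: in_mball)
      finally show "z \<in> mball x r"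
        using z r by auto
    qed
    then show "\<exists>V\<in>\<B>. x \<in> V \<and> V \<subseteq> U"
      using y r unfolding \<B>_def by blast
  qed
qed

text \<open>
  Deleting all countable members of a countable base leaves a closed set \<open>P\<close> of condensation
  points.  Every nonempty relatively open subset of \<open>P\<close> is uncountable, which leaves room for two
  disjoint countable dense subsets \<open>E\<close> and \<open>E'\<close> of \<open>P\<close>.  If countably many closed sets cover
  the space, then by the Baire category theorem one of them contains a nonempty relatively open
  subset of \<open>P\<close>, and therefore meets both \<open>E\<close> and \<open>E'\<close>.
\<close>
lemma countable_sets_not_sigma_separated:
  assumes X: "compact_space X" "metrizable_space X" "uncountable (topspace X)"
  obtains E E' where "E \<subseteq> topspace X" "E' \<subseteq> topspace X" "countable E" "countable E'" "E \<inter> E' = {}"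
    "\<And>\<F> \<F>'. \<lbrakk>countable \<F>; countable \<F>'; \<And>F. F \<in> \<F> \<union> \<F>' \<Longrightarrow> closedin X F;
       topspace X \<subseteq> \<Union>\<F> \<union> \<Union>\<F>'\<rbrakk> \<Longrightarrow> (\<exists>F\<in>\<F>. F \<inter> E \<noteq> {}) \<or> (\<exists>F\<in>\<F>'. F \<inter> E' \<noteq> {})"
proof -
  obtain \<B> where \<B>: "countable \<B>" "\<And>V. V \<in> \<B> \<Longrightarrow> openin X V"
    and base: "\<And>U x. openin X U \<Longrightarrow> x \<in> U \<Longrightarrow> \<exists>V\<in>\<B>. x \<in> V \<and> V \<subseteq> U"
    using second_countable_compact_metrizable[OF X(1,2)] unfolding second_countable_def by metis
  define N where "N = (\<Union>V\<in>{V \<in> \<B>. countable V}. V)"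
  define P where "P = topspace X - N"
  have N: "countable N"
    unfolding N_def using \<B> by (intro countable_UN) auto
  have P_ne: "P \<noteq> {}"
    using N X(3) unfolding P_def by (metis Diff_eq_empty_iff countable_subset)
  have P: "closedin X P"
    unfolding P_def N_def using \<B> by (intro closedin_diff openin_Union) auto
  define \<B>' where "\<B>' = {V \<in> \<B>. V \<inter> P \<noteq> {}}"
  have unc: "uncountable (V \<inter> P)" if "V \<in> \<B>'" for V
  proof
    assume "countable (V \<inter> P)"
    then have "countable (N \<union> V \<inter> P)"
      using N by simp
    moreover have "V \<subseteq> N \<union> V \<inter> P"
      using that openin_subset[OF \<B>(2)] by (auto simp: \<B>'_def P_def)
    ultimately have "countable V"
      using countable_subset by blast
    then show False
      using that unfolding \<B>'_def P_def N_def by blast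
  qed
  have "\<exists>e. \<forall>V\<in>\<B>'. e V \<in> V \<inter> P"
    by (intro bchoice) (auto simp: \<B>'_def)
  then obtain e where e: "\<And>V. V \<in> \<B>' \<Longrightarrow> e V \<in> V \<inter> P"
    by blast
  define E where "E = e ` \<B>'"
  have E: "countable E"
    unfolding E_def using \<B>(1) by (simp add: \<B>'_def)
  have "\<exists>e. \<forall>V\<in>\<B>'. e V \<in> V \<inter> P - E"
  proof (intro bchoice ballI)
    fix V assume "V \<in> \<B>'"
    from uncountable_minus_countable[OF unc[OF this] E] show "\<exists>x. x \<in> V \<inter> P - E"
      by (metis countable_empty ex_in_conv)
  qed
  then obtain e' where e': "\<And>V. V \<in> \<B>' \<Longrightarrow> e' V \<in> V \<inter> P - E"
    by blast
  define E' where "E' = e' ` \<B>'"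
  have E': "countable E'"
    unfolding E'_def using \<B>(1) by (simp add: \<B>'_def)
  have dense: "F \<inter> E \<noteq> {} \<and> F \<inter> E' \<noteq> {}" if int: "subtopology X P interior_of F \<noteq> {}" for F
  proof -
    obtain U where U: "openin X U" "subtopology X P interior_of F = U \<inter> P"
      using openin_interior_of[of "subtopology X P" F] unfolding openin_subtopology by metis
    moreover obtain x where "x \<in> U" "x \<in> P"
      using int U(2) by auto
    moreover have "U \<inter> P \<subseteq> F"
      using U(2) interior_of_subset[of "subtopology X P" F] by simp
    ultimately have "openin X U" "U \<inter> P \<subseteq> F" "x \<in> U" "x \<in> P"
      by auto
    then obtain V where "V \<in> \<B>'" "V \<inter> P \<subseteq> F"
      using base[of U x] unfolding \<B>'_def by blast
    then show ?thesis
      using e e' unfolding E_def E'_def by blast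
  qed
  show thesis
  proof (rule that[OF _ _ E E'])
    show "E \<subseteq> topspace X" "E' \<subseteq> topspace X"
      using e e' by (auto simp: E_def E'_def P_def)
    show "E \<inter> E' = {}"
      using e' by (auto simp: E'_def)
    fix \<F> \<F>' assume \<F>: "countable \<F>" "countable \<F>'" "\<And>F. F \<in> \<F> \<union> \<F>' \<Longrightarrow> closedin X F"
      "topspace X \<subseteq> \<Union>\<F> \<union> \<Union>\<F>'"
    let ?Y = "subtopology X P"
    let ?\<G> = "(\<lambda>F. P \<inter> F) ` (\<F> \<union> \<F>')"
    have "\<exists>F\<in>\<F> \<union> \<F>'. ?Y interior_of (P \<inter> F) \<noteq> {}"
    proof (rule ccontr)
      assume *: "\<not> (\<exists>F\<in>\<F> \<union> \<F>'. ?Y interior_of (P \<inter> F) \<noteq> {})"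
      have "compact_space ?Y"
        using X(1) P by (simp add: closedin_compact_space compact_space_subtopology)
      moreover have "metrizable_space ?Y"
        using X(2) by (simp add: metrizable_space_subtopology)
      ultimately have "?Y interior_of \<Union>?\<G> = {}"
        using \<F> * by (intro Baire_category_alt)
          (auto simp: compact_imp_locally_compact_space metrizable_imp_regular_space
             intro: closedin_subtopology_Int_closed)
      moreover have "\<Union>?\<G> = topspace ?Y" "topspace ?Y = P"
        using \<F>(4) closedin_subset[OF P] by auto
      ultimately show False
        using P_ne interior_of_topspace[of ?Y] by simp
    qed
    then obtain F where "F \<in> \<F> \<union> \<F>'" "F \<inter> E \<noteq> {}" "F \<inter> E' \<noteq> {}"
      using dense[of "P \<inter> F" for F] by blast
    then show "(\<exists>F\<in>\<F>. F \<inter> E \<noteq> {}) \<or> (\<exists>F\<in>\<F>'. F \<inter> E' \<noteq> {})"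
      by auto
  qed
qed

section \<open>Envelopes in the dual space\<close>

lemma subspace_dual: "subspace (dual sc)"
  by (rule subspaceI)
    (auto simp: dual_def blinfun.add_left blinfun.scaleR_left algebra_simps scaleR_conv_of_real)

lemma scale_functional_minus_one: "scale_functional (-1) \<phi> = - \<phi>"
  by (rule blinfun_eqI) (simp add: scale_functional_def blinfun.minus_left)

lemma topspace_weak_star: "topspace (weak_star_topology sc) = dual sc"
  by (simp add: weak_star_topology_def strong_operator_topology_topspace)

lemma closedin_weak_star_singleton:
  assumes "\<phi> \<in> dual sc"
  shows "closedin (weak_star_topology sc) {\<phi>}"
proof -
  have "closedin strong_operator_topology {\<psi>. blinfun_apply \<psi> x = blinfun_apply \<phi> x}" for x
    using closedin_continuous_map_preimage[OF strong_operator_topology_continuous_evaluation,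
        of "{blinfun_apply \<phi> x}" x]
    by (simp add: strong_operator_topology_topspace)
  then have "closedin strong_operator_topology (\<Inter>x. {\<psi>. blinfun_apply \<psi> x = blinfun_apply \<phi> x})"
    by (intro closedin_Inter) auto
  also have "(\<Inter>x. {\<psi>. blinfun_apply \<psi> x = blinfun_apply \<phi> x}) = {\<phi>}"
    by (auto intro: blinfun_eqI)
  finally show ?thesis
    using assms unfolding weak_star_topology_def by (intro closedin_subset_topspace) auto
qed

text \<open>Cover \<open>S\<close> by singletons, which are weak* closed.\<close>
lemma I_env_countable_subset_closure:
  assumes "countable S" "S \<noteq> {}" "S \<subseteq> dual sc"
  shows "I_env sc S \<subseteq> closure (convex hull S)"
proof -
  define f where "f = from_nat_into S"
  have f: "S = (\<Union>n. {f n})"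
    using range_from_nat_into[OF assms(2,1)] by (auto simp: f_def)
  have "weak_star_topology sc closure_of (convex hull {f n}) = {f n}" for n
    using assms f by (auto simp: closure_of_eq intro!: closedin_weak_star_singleton)
  then have "(\<Union>n. weak_star_topology sc closure_of (convex hull {f n})) = S"
    using f by simp
  then have "I_env sc S \<subseteq> top_of_set (dual sc) closure_of (convex hull S)"
    unfolding I_env_def using f by (intro Inter_lower) (auto intro!: exI[of _ "\<lambda>n. {f n}"])
  also have "\<dots> \<subseteq> closure (convex hull S)"
    by (metis closure_of_subtopology_subset euclidean_closure_of)
  finally show ?thesis .
qed

lemma subset_weak_star_closure_hull:
  assumes "B \<subseteq> dual sc"
  shows "B \<subseteq> weak_star_topology sc closure_of (convex hull B)"
proof -
  have "convex hull B \<subseteq> dual sc"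
    using assms by (intro hull_minimal subspace_imp_convex subspace_dual)
  then show ?thesis
    using closure_of_subset[of "convex hull B" "weak_star_topology sc"] hull_subset[of B convex]
    by (auto simp: topspace_weak_star)
qed

text \<open>
  Unfolds what it means for \<open>x\<close> to be outside of the envelope, with the norm closed convex hull
  of the definition as the set \<open>N\<close>.
\<close>
lemma I_env_excluding_cover:
  assumes "x \<notin> I_env sc S" "S \<subseteq> dual sc"
  obtains B N where "S = (\<Union>n::nat. B n)" "convex N" "closedin (top_of_set (dual sc)) N"
    "x \<notin> N" "S \<subseteq> N" "\<And>n. weak_star_topology sc closure_of (convex hull (B n)) \<subseteq> N"
proof -
  have "\<exists>B :: nat \<Rightarrow> _. S = (\<Union>n. B n) \<and> x \<notin> top_of_set (dual sc) closure_of
          (convex hull (\<Union>n. weak_star_topology sc closure_of (convex hull (B n))))"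
  proof (rule ccontr)
    assume "\<nexists>B :: nat \<Rightarrow> _. S = (\<Union>n. B n) \<and> x \<notin> top_of_set (dual sc) closure_of
          (convex hull (\<Union>n. weak_star_topology sc closure_of (convex hull (B n))))"
    then have "x \<in> I_env sc S"
      unfolding I_env_def by (intro InterI) (elim CollectE exE conjE, simp)
    then show False
      using assms by simp
  qed
  then obtain B :: "nat \<Rightarrow> _" where B: "S = (\<Union>n. B n)"
    "x \<notin> top_of_set (dual sc) closure_of
          (convex hull (\<Union>n. weak_star_topology sc closure_of (convex hull (B n))))"
    by (elim exE conjE)
  let ?W = "\<lambda>n. weak_star_topology sc closure_of (convex hull (B n))"
  define H where "H = convex hull (\<Union>n. ?W n)"
  have W: "?W n \<subseteq> dual sc" for n
    by (metis closure_of_subset_topspace topspace_weak_star)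
  have H: "H \<subseteq> dual sc"
    unfolding H_def by (intro hull_minimal subspace_imp_convex subspace_dual UN_least W)
  then have N: "top_of_set (dual sc) closure_of H = dual sc \<inter> closure H"
    by (simp add: closure_of_subtopology Int_absorb1)
  have HN: "H \<subseteq> dual sc \<inter> closure H"
    using H closure_subset by blast
  have BW: "B n \<subseteq> ?W n" for n
    using B(1) assms(2) by (intro subset_weak_star_closure_hull) auto
  have WH: "?W n \<subseteq> H" for n
    unfolding H_def using hull_subset[of "\<Union>n. ?W n" convex] by blast
  show thesis
  proof (rule that[OF B(1)])
    show "convex (dual sc \<inter> closure H)"
      unfolding H_def by (intro convex_Int convex_closure subspace_imp_convex subspace_dual convex_convex_hull)
    show "closedin (top_of_set (dual sc)) (dual sc \<inter> closure H)"
      by (simp add: closedin_closed_Int)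
    show "x \<notin> dual sc \<inter> closure H"
      using B(2) N by (simp add: H_def)
    show "S \<subseteq> dual sc \<inter> closure H" "\<And>n. ?W n \<subseteq> dual sc \<inter> closure H"
      using HN WH BW B(1) by blast+
  qed
qed

section \<open>Point masses\<close>

definition dirac :: "'k::topological_space \<Rightarrow> (('k \<Rightarrow>\<^sub>C 's::real_normed_field) \<Rightarrow>\<^sub>L 's)"
  where "dirac x = Blinfun (\<lambda>f. apply_bcontfun f x)"

lemma dirac_apply [simp]:
  fixes f :: "'k::topological_space \<Rightarrow>\<^sub>C 's::real_normed_field"
  shows "blinfun_apply (dirac x) f = apply_bcontfun f x"
proof -
  have "bounded_linear (\<lambda>f :: 'k \<Rightarrow>\<^sub>C 's. apply_bcontfun f x)"
    by (rule bounded_linear_intro[of _ 1]) (auto simp: norm_bounded)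
  then show ?thesis
    by (simp add: dirac_def bounded_linear_Blinfun_apply)
qed

lemma dirac_in_dual: "dirac x \<in> dual scale_bcontfun"
  by (simp add: dual_def apply_scale_bcontfun)

lemma continuous_map_dirac: "continuous_map euclidean (weak_star_topology scale_bcontfun) dirac"
  by (auto simp: weak_star_topology_def continuous_map_in_subtopology dirac_in_dual
      continuous_on_strong_operator_topo_iff_coordinatewise)

lemma bcontfun_separating_finite_sets:
  fixes G G' :: "'k::topological_space set"
  assumes K: "compact (UNIV :: 'k set)" "metrizable_space (euclidean :: 'k topology)"
    and "finite G" "finite G'" "G \<inter> G' = {}"
  obtains f :: "'k \<Rightarrow>\<^sub>C 's::real_normed_field" where "norm f \<le> 1"
    "\<And>x. x \<in> G \<Longrightarrow> apply_bcontfun f x = 1" "\<And>x. x \<in> G' \<Longrightarrow> apply_bcontfun f x = 0"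
proof -
  have "t1_space (euclidean :: 'k topology)"
    using K by (rule_tac metrizable_imp_t1_space)
  then have "closedin euclidean G" "closedin euclidean G'"
    using assms by (auto simp: t1_space_closedin_finite)
  then obtain g where g: "continuous_map euclidean (top_of_set {0..1::real}) g"
    "g ` G' \<subseteq> {0}" "g ` G \<subseteq> {1}"
    using Urysohn_lemma[OF metrizable_imp_normal_space[OF K(2)], of G' G 0 1] assms(5)
    by (auto simp: disjnt_def)
  then have cont: "continuous_on UNIV g" and range: "\<And>x. g x \<in> {0..1}"
    by (auto simp: continuous_map_in_subtopology)
  have "(\<lambda>x. of_real (g x) :: 's) \<in> bcontfun"
    using cont range by (auto simp: bcontfun_def bounded_iff intro!: continuous_intros exI[of _ 1])
  then obtain f :: "'k \<Rightarrow>\<^sub>C 's" where f: "\<And>x. apply_bcontfun f x = of_real (g x)"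
    by (metis bcontfunE)
  have "dist f 0 \<le> 1"
    using range by (intro dist_bound) (auto simp: f dist_norm)
  then show thesis
    using g f by (intro that[of f]) (auto simp: dist_norm)
qed

text \<open>
  Each element of the span involves only finitely many points.  It therefore vanishes at every
  function that is \<open>1\<close> at those in \<open>E\<close> (and at \<open>e0\<close>) and \<open>0\<close> at those in \<open>E'\<close>.  There is such a function of
  norm at most \<open>1\<close>, and the point mass at \<open>e0\<close> takes the value \<open>1\<close> there, so the distance to the span is
  at least \<open>1\<close>.
\<close>
lemma dirac_not_in_closure_span:
  fixes E E' :: "'k::topological_space set"
  assumes K: "compact (UNIV :: 'k set)" "metrizable_space (euclidean :: 'k topology)"
    and disj: "E \<inter> E' = {}" and e0: "e0 \<in> E"
  shows "(dirac e0 :: ('k \<Rightarrow>\<^sub>C 's::real_normed_field) \<Rightarrow>\<^sub>L 's) \<notin>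
    closure (span (dirac ` E' \<union> (\<lambda>e. dirac e - dirac e0) ` E))"
proof -
  let ?S = "dirac ` E' \<union> (\<lambda>e. dirac e - dirac e0) ` E :: (('k \<Rightarrow>\<^sub>C 's) \<Rightarrow>\<^sub>L 's) set"
  have kill: "\<exists>G G'. finite G \<and> finite G' \<and> G \<subseteq> E \<and> G' \<subseteq> E' \<and>
      (\<forall>f. (\<forall>x\<in>G. apply_bcontfun f x = 1) \<and> (\<forall>x\<in>G'. apply_bcontfun f x = 0) \<longrightarrow> blinfun_apply \<mu> f = 0)"
    if "\<mu> \<in> span ?S" for \<mu>
    using that
  proof (induction rule: span_induct_alt)
    case base
    show ?case
      by (rule exI[of _ "{}"], rule exI[of _ "{}"]) simp
  next
    case (step c \<nu> \<mu>)
    from step.IH obtain G G' where IH: "finite G" "finite G'" "G \<subseteq> E" "G' \<subseteq> E'"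
      "\<And>f. (\<forall>x\<in>G. apply_bcontfun f x = 1) \<and> (\<forall>x\<in>G'. apply_bcontfun f x = 0) \<Longrightarrow> blinfun_apply \<mu> f = 0"
      by blast
    from step.hyps consider e' where "e' \<in> E'" "\<nu> = dirac e'"
      | e where "e \<in> E" "\<nu> = dirac e - dirac e0"
      by blast
    then show ?case
    proof cases
      case 1
      show ?thesis
        by (rule exI[of _ G], rule exI[of _ "insert e' G'"])
          (use IH 1 in \<open>auto simp: blinfun.add_left blinfun.scaleR_left\<close>)
    next
      case 2
      show ?thesis
        by (rule exI[of _ "insert e (insert e0 G)"], rule exI[of _ G'])
          (use IH 2 e0 in \<open>auto simp: blinfun.add_left blinfun.scaleR_left blinfun.diff_left\<close>)
    qed
  qed
  have far: "1 \<le> dist \<mu> (dirac e0)" if \<mu>: "\<mu> \<in> span ?S" for \<mu>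
  proof -
    obtain G G' where G: "finite G" "finite G'" "G \<subseteq> E" "G' \<subseteq> E'" 
      "\<And>f. (\<forall>x\<in>G. apply_bcontfun f x = 1) \<and> (\<forall>x\<in>G'. apply_bcontfun f x = 0) \<Longrightarrow> blinfun_apply \<mu> f = 0"
      using kill[OF \<mu>] by blast
    moreover have "insert e0 G \<inter> G' = {}"
      using G disj e0 by blast
    ultimately obtain f :: "'k \<Rightarrow>\<^sub>C 's" where f: "norm f \<le> 1"
      "\<And>x. x \<in> insert e0 G \<Longrightarrow> apply_bcontfun f x = 1" "\<And>x. x \<in> G' \<Longrightarrow> apply_bcontfun f x = 0"
      using bcontfun_separating_finite_sets[OF K, of "insert e0 G" G'] by (metis finite_insert)
    then have "blinfun_apply \<mu> f = 0"
      using G by blast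
    then have "1 = norm (blinfun_apply (\<mu> - dirac e0) f)"
      using f by (simp add: blinfun.diff_left)
    also have "\<dots> \<le> norm (\<mu> - dirac e0) * norm f"
      by (rule norm_blinfun)
    also have "\<dots> \<le> norm (\<mu> - dirac e0) * 1"
      using f by (intro mult_left_mono) auto
    finally show ?thesis
      by (simp add: dist_norm)
  qed
  show ?thesis
    using far unfolding closure_approachable by (meson less_le_not_le zero_less_one)
qed

section \<open>No locally convex topology yields the envelope\<close>

text \<open>
  Topology and convexity enter only through real scalars, so one argument serves all normed
  fields.
\<close>
lemma no_topology_for_I_env:
  assumes K: "compact (UNIV :: 'k::topological_space set)"
    "metrizable_space (euclidean :: 'k topology)" "uncountable (UNIV :: 'k set)"
  shows "\<nexists>\<tau> :: (('k \<Rightarrow>\<^sub>C 's::real_normed_field) \<Rightarrow>\<^sub>L 's) topology.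
    locally_convex_topology scale_functional (dual scale_bcontfun) \<tau> \<and>
    (\<forall>A \<subseteq> dual scale_bcontfun. I_env scale_bcontfun A = \<tau> closure_of (convex hull A))"
proof (rule notI, elim exE conjE)
  fix \<tau> :: "(('k \<Rightarrow>\<^sub>C 's) \<Rightarrow>\<^sub>L 's) topology"
  assume lc: "locally_convex_topology scale_functional (dual scale_bcontfun) \<tau>"
    and "\<forall>A \<subseteq> dual scale_bcontfun. I_env scale_bcontfun A = \<tau> closure_of (convex hull A)"
  then have I_env: "I_env scale_bcontfun A = \<tau> closure_of (convex hull A)"
    if "A \<subseteq> dual scale_bcontfun" for A
    using that by simp
  let ?dual = "dual scale_bcontfun :: (('k \<Rightarrow>\<^sub>C 's) \<Rightarrow>\<^sub>L 's) set"
  let ?W = "\<lambda>B. weak_star_topology scale_bcontfun closure_of (convex hull B) :: (('k \<Rightarrow>\<^sub>C 's) \<Rightarrow>\<^sub>L 's) set"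
  have dual: "subspace ?dual"
    by (rule subspace_dual)
  have "compact_space (euclidean :: 'k topology)" "uncountable (topspace (euclidean :: 'k topology))"
    using K by (simp_all add: compact_space_def)
  from countable_sets_not_sigma_separated[OF this(1) K(2) this(2)]
  obtain E E' :: "'k set" where E: "countable E" "countable E'" "E \<inter> E' = {}"
    and nonsep: "\<And>\<F> \<F>'. \<lbrakk>countable \<F>; countable \<F>'; \<And>F. F \<in> \<F> \<union> \<F>' \<Longrightarrow> closedin euclidean F;
       topspace euclidean \<subseteq> \<Union>\<F> \<union> \<Union>\<F>'\<rbrakk> \<Longrightarrow> (\<exists>F\<in>\<F>. F \<inter> E \<noteq> {}) \<or> (\<exists>F\<in>\<F>'. F \<inter> E' \<noteq> {})"
    by metis
  obtain e0 where e0: "e0 \<in> E"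
    using nonsep[of "{UNIV}" "{}"] by auto
  define S :: "(('k \<Rightarrow>\<^sub>C 's) \<Rightarrow>\<^sub>L 's) set"
    where "S = dirac ` E' \<union> (\<lambda>e. dirac e - dirac e0) ` E"
  define A where "A = span S"
  have S: "countable S" "S \<noteq> {}" "S \<subseteq> ?dual"
    using E e0 dual by (auto simp: S_def dirac_in_dual subspace_diff)
  have A: "subspace A" "A \<subseteq> ?dual"
    using S dual by (auto simp: A_def intro: span_minimal[THEN subsetD])
  define T where "T = (\<lambda>(n::int, s). of_int n *\<^sub>R s) ` (UNIV \<times> S)"
  have hull_T: "convex hull T = A"
    unfolding T_def A_def using S by (intro convex_hull_int_multiples)
  then have T: "T \<subseteq> ?dual" "T \<noteq> {}" "countable T"
    using hull_subset[of T convex] A S by (auto simp: T_def)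
  have "dirac e0 \<notin> \<tau> closure_of A"
    using dirac_not_in_closure_span[OF K(1,2) E(3) e0] I_env_countable_subset_closure[OF T(3,2,1)]
      I_env[OF T(1)] hull_T unfolding A_def S_def by auto
  then obtain C D where CD: "convex C" "convex D" "C \<inter> D = {}" "C \<union> D = UNIV"
    "A \<subseteq> C" "\<And>a. a \<in> A \<Longrightarrow> dirac e0 + a \<in> D"
    "dirac e0 \<notin> \<tau> closure_of (?dual \<inter> C)" "0 \<notin> \<tau> closure_of (?dual \<inter> D)"
    using convex_splitting_of_locally_convex_space[OF lc dual _ A dirac_in_dual]
    by (metis scale_functional_minus_one)
  have "convex (?dual \<inter> C)" "convex (?dual \<inter> D)"
    using CD dual by (auto intro: convex_Int subspace_imp_convex)
  then have "dirac e0 \<notin> I_env scale_bcontfun (?dual \<inter> C)" "0 \<notin> I_env scale_bcontfun (?dual \<inter> D)"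
    using CD by (simp_all add: I_env hull_same)
  obtain B N where B: "?dual \<inter> C = (\<Union>n::nat. B n)" "convex N" "closedin (top_of_set ?dual) N"
    "dirac e0 \<notin> N" "?dual \<inter> C \<subseteq> N" "\<And>n. ?W (B n) \<subseteq> N"
    using I_env_excluding_cover[OF \<open>dirac e0 \<notin> I_env _ _\<close>] by blast
  obtain B' N' where B': "?dual \<inter> D = (\<Union>n::nat. B' n)" "convex N'" "closedin (top_of_set ?dual) N'"
    "0 \<notin> N'" "?dual \<inter> D \<subseteq> N'" "\<And>n. ?W (B' n) \<subseteq> N'"
    using I_env_excluding_cover[OF \<open>0 \<notin> I_env _ _\<close>] by blast
  \<comment> \<open>On \<open>E\<close> all point masses agree modulo \<open>A\<close>, and one of them is not in \<open>N \<supseteq> A\<close>.\<close>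
  have NE: "dirac e \<notin> N" if "e \<in> E" for e
  proof
    assume "dirac e \<in> N"
    moreover have "- (dirac e - dirac e0) \<in> A"
      unfolding A_def by (intro span_neg span_base) (use that in \<open>auto simp: S_def\<close>)
    moreover have "0 + a \<in> N" if "a \<in> A" for a
      using that A(2) CD(5) B(5) by auto
    ultimately have "dirac e + - (dirac e - dirac e0) \<in> N"
      using closed_convex_plus_subspace[OF B(2,3) dual A] by blast
    then show False
      using B by simp
  qed
  \<comment> \<open>The point masses on \<open>E'\<close> belong to \<open>A\<close>, and \<open>N'\<close> contains a translate of \<open>A\<close>.\<close>
  have NE': "dirac e \<notin> N'" if "e \<in> E'" for e
  proof
    assume "dirac e \<in> N'"
    moreover have "- dirac e \<in> A"
      unfolding A_def by (intro span_neg span_base) (use that in \<open>auto simp: S_def\<close>)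
    moreover have "dirac e0 + a \<in> N'" if "a \<in> A" for a
      using that A(2) CD(6) by (intro B'(5)[THEN subsetD] IntI subspace_add[OF dual] dirac_in_dual) auto
    ultimately have "dirac e + - dirac e \<in> N'"
      using closed_convex_plus_subspace[OF B'(2,3) dual A] by blast
    then show False
      using B' by simp
  qed
  define F where "F = (\<lambda>B. {x. dirac x \<in> ?W B})"
  have closed_F: "closed (F B)" for B
    using closedin_continuous_map_preimage[OF continuous_map_dirac, of "?W B"] by (simp add: F_def)
  have "x \<in> (\<Union>n. F (B n)) \<union> (\<Union>n. F (B' n))" for x
  proof -
    have "dirac x \<in> (\<Union>n. B n) \<union> (\<Union>n. B' n)"
      using CD(4) dirac_in_dual[of x] unfolding B(1)[symmetric] B'(1)[symmetric] by blast
    moreover have "B n \<subseteq> ?W (B n)" "B' n \<subseteq> ?W (B' n)" for n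
      using B(1) B'(1) by (auto intro!: subset_weak_star_closure_hull)
    ultimately show ?thesis
      unfolding F_def by blast
  qed
  then have "(\<Union>n. F (B n)) \<union> (\<Union>n. F (B' n)) = UNIV"
    by blast
  then have "(\<exists>G\<in>range (\<lambda>n. F (B n)). G \<inter> E \<noteq> {}) \<or> (\<exists>G\<in>range (\<lambda>n. F (B' n)). G \<inter> E' \<noteq> {})"
    by (intro nonsep) (auto simp: closed_F)
  then show False
    using NE NE' B(6) B'(6) unfolding F_def by blast
qed

theorem theorem3p8:
  assumes "compact (UNIV :: 'k::topological_space set)"
    and "metrizable_space (euclidean :: 'k topology)"
    and "uncountable (UNIV :: 'k set)"
  shows
    "(\<nexists>\<tau> :: (('k \<Rightarrow>\<^sub>C real) \<Rightarrow>\<^sub>L real) topology.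
        locally_convex_topology scale_functional (dual scale_bcontfun) \<tau> \<and>
        (\<forall>A \<subseteq> dual scale_bcontfun. I_env scale_bcontfun A = \<tau> closure_of (convex hull A))) \<and>
     (\<nexists>\<tau> :: (('k \<Rightarrow>\<^sub>C complex) \<Rightarrow>\<^sub>L complex) topology.
        locally_convex_topology scale_functional (dual scale_bcontfun) \<tau> \<and>
        (\<forall>A \<subseteq> dual scale_bcontfun. I_env scale_bcontfun A = \<tau> closure_of (convex hull A)))"
  by (intro conjI no_topology_for_I_env[OF assms])

end
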